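(* Let $N\ge 2$, $1\le N_2<N$, and let $A,B$ be real symmetric $N\times N$ matrices such that $$B=\begin{pmatrix}0&0\\0&\widetilde B\end{pmatrix}$$ with $\widetilde B$ a symmetric positive definite $N_2\times N_2$ matrix, and such that the $N\times N^2$ matrix $\mathcal K(A,B)=(B\,|\,AB\,|\,\cdots\,|\,A^{N-1}B)$ has full rank $N$ (Kalman rank condition). Then there exists a constant $C>0$, independent of the mesh-size $h$, of the time $t$ and of the initial datum $U_0$, such that for every $h>0$, every $U_0\in h^1_h$ and every $t>0$, the solution $U=(U_1,U_2)$ of $$\partial_tU(t)+A(\mathcal D_hU(t))=-BU(t),\qquad U(0)=U_0,$$ satisfies $$\|U_2(t)\|_{\ell^2_h}+\|\mathcal D_hU(t)\|_{\ell^2_h}\le C(1+t)^{-\frac12}\|U_0\|_{h^1_h}.$$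
   Context: For $h>0$ and a sequence $v=(v_n)_{n\in\mathbb Z}$ of real numbers or of vectors in some $\mathbb R^m$, put $\|v\|_{\ell^2_h}^2:=h\sum_{n\in\mathbb Z}|v_n|^2$, where $|\cdot|$ is the Euclidean norm, and let $\ell^2_h$ be the set of sequences with finite norm. The central finite difference operator is $(\mathcal D_hv)_n:=\frac{v_{n+1}-v_{n-1}}{2h}$. The inhomogeneous discrete Sobolev norm is $\|v\|_{h^1_h}^2:=\|v\|_{\ell^2_h}^2+\|\mathcal D_hv\|_{\ell^2_h}^2$, and $h^1_h$ is the set of sequences for which it is finite. The unknown $U:[0,\infty)\times\mathbb Z\to\mathbb R^N$ is regarded as a function of time with values in sequences of vectors; matrices act componentwise in $n$, i.e. $(AU)_n=AU_n$. Every $\mathbb R^N$-valued $U$ is decomposed as $U=(U_1,U_2)$ with $U_1$ taking values in $\mathbb R^{N-N_2}$ (the first $N-N_2$ components) and $U_2$ in $\mathbb R^{N_2}$ (the last $N_2$ components). Since $\mathcal D_h$ is bounded on $\ell^2_h$, the Cauchy problem has a unique solution in $C^1([0,\infty);\ell^2_h)$; this is the solution meant. *)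

theory Defs
  imports "HOL-Analysis.Analysis" "HOL-Library.Countable_Set"
begin

text \<open>As a set, the discrete space over the mesh of size h > 0 does not depend on h.\<close>

definition l2h :: "(int \<Rightarrow> 'v::real_normed_vector) set" where
  "l2h = {v. (\<lambda>n. (norm (v n))\<^sup>2) summable_on UNIV}"

text \<open>Only meaningful on \<open>l2h\<close>: \<open>infsum\<close> returns 0 on families that are not summable.\<close>

definition l2h_norm :: "real \<Rightarrow> (int \<Rightarrow> 'v::real_normed_vector) \<Rightarrow> real" where
  "l2h_norm h v = sqrt (h * (\<Sum>\<^sub>\<infinity>n. (norm (v n))\<^sup>2))"

definition Dh :: "real \<Rightarrow> (int \<Rightarrow> 'v::real_normed_vector) \<Rightarrow> int \<Rightarrow> 'v" where
  "Dh h v n = (v (n + 1) - v (n - 1)) /\<^sub>R (2 * h)"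

definition h1h :: "real \<Rightarrow> (int \<Rightarrow> 'v::real_normed_vector) set" where
  "h1h h = {v. v \<in> l2h \<and> Dh h v \<in> l2h}"

definition h1h_norm :: "real \<Rightarrow> (int \<Rightarrow> 'v::real_normed_vector) \<Rightarrow> real" where
  "h1h_norm h v = sqrt ((l2h_norm h v)\<^sup>2 + (l2h_norm h (Dh h v))\<^sup>2)"

text \<open>\<open>U\<close> is continuously differentiable on \<open>[0, \<infinity>)\<close> with derivative \<open>V\<close>, as a function with
  values in the normed space \<open>l2h\<close>. The derivative is one-sided at 0, and values at negative times
  are irrelevant.\<close>

definition C1_l2h ::
    "real \<Rightarrow> (real \<Rightarrow> int \<Rightarrow> 'v::real_normed_vector) \<Rightarrow> (real \<Rightarrow> int \<Rightarrow> 'v) \<Rightarrow> bool" where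
  "C1_l2h h U V \<longleftrightarrow>
     (\<forall>t\<ge>0. U t \<in> l2h \<and> V t \<in> l2h) \<and>
     (\<forall>t\<ge>0. ((\<lambda>s. l2h_norm h (\<lambda>n. (U s n - U t n) /\<^sub>R (s - t) - V t n)) \<longlongrightarrow> 0)
               (at t within {0..})) \<and>
     (\<forall>t\<ge>0. ((\<lambda>s. l2h_norm h (\<lambda>n. V s n - V t n)) \<longlongrightarrow> 0) (at t within {0..}))"

definition is_solution ::
    "real^'n^'n \<Rightarrow> real^'n^'n \<Rightarrow> real \<Rightarrow> (int \<Rightarrow> real^'n::finite) \<Rightarrow> (real \<Rightarrow> int \<Rightarrow> real^'n) \<Rightarrow> bool"
  where
  "is_solution A B h U0 U \<longleftrightarrow>
     (\<exists>V. C1_l2h h U V \<and>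
          (\<forall>t\<ge>0. \<forall>n. V t n + A *v Dh h (U t) n = - (B *v U t n))) \<and>
     U 0 = U0"

text \<open>The index type \<open>'a + 'b\<close> splits a vector into its first \<open>CARD('a)\<close> (\<open>Inl\<close>) and its last
  \<open>CARD('b)\<close> (\<open>Inr\<close>) components.\<close>

definition snd_block :: "real^('a::finite + 'b::finite) \<Rightarrow> real^'b" where
  "snd_block x = (\<chi> j. x $ Inr j)"

definition lower_block :: "real^'b^'b \<Rightarrow> real^('a::finite + 'b::finite)^('a + 'b)" where
  "lower_block M = (\<chi> i j. case (i, j) of (Inr k, Inr l) \<Rightarrow> M $ k $ l | _ \<Rightarrow> 0)"

definition symmetric_matrix :: "real^'n^'n::finite \<Rightarrow> bool" where
  "symmetric_matrix M \<longleftrightarrow> transpose M = M"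

definition positive_definite :: "real^'n^'n::finite \<Rightarrow> bool" where
  "positive_definite M \<longleftrightarrow> (\<forall>x. x \<noteq> 0 \<longrightarrow> 0 < x \<bullet> (M *v x))"

text \<open>The power \<open>^\<close> on \<open>real^'n^'n\<close> is the componentwise one, hence a separate matrix power.\<close>

primrec matrix_power :: "real^'n^'n \<Rightarrow> nat \<Rightarrow> real^'n^'n::finite" where
  "matrix_power A 0 = mat 1"
| "matrix_power A (Suc k) = A ** matrix_power A k"

text \<open>The columns are indexed by pairs of a block \<open>k\<close> and a column \<open>j\<close> within it. The enumeration
  \<open>to_nat_on UNIV\<close> is a bijection from the finite type \<open>'n\<close> onto \<open>{..<CARD('n)}\<close>, so that the
  exponents of \<open>A\<close> run exactly once through \<open>0, ..., N - 1\<close> with \<open>N = CARD('n)\<close>.\<close>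

definition kalman_matrix :: "real^'n^'n \<Rightarrow> real^'n^'n \<Rightarrow> real^('n \<times> 'n)^'n::finite" where
  "kalman_matrix A B =
     (\<chi> i kj. (matrix_power A (to_nat_on (UNIV :: 'n set) (fst kj)) ** B) $ i $ snd kj)"

end

theory Submission
  imports Defs
begin

text \<open>Write \<open>D\<close> for the central difference operator. It is skew-adjoint and commutes with matrices,
  so both \<open>\<parallel>U\<parallel>\<^sup>2\<close> and \<open>\<parallel>D U\<parallel>\<^sup>2\<close> decrease, at rates bounding \<open>\<parallel>B U\<parallel>\<^sup>2\<close> and \<open>\<parallel>B D U\<parallel>\<^sup>2\<close>. The time
  derivative of \<open>\<langle>B A\<^sup>j U, B A\<^sup>j\<^sup>+\<^sup>1 D U\<rangle>\<close> contains \<open>-\<parallel>B A\<^sup>j\<^sup>+\<^sup>1 D U\<parallel>\<^sup>2\<close>, and up to a small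
  multiple of \<open>\<parallel>D U\<parallel>\<^sup>2\<close> all its other terms are controlled by \<open>\<parallel>B A\<^sup>j D U\<parallel>\<^sup>2\<close> and \<open>\<parallel>B U\<parallel>\<^sup>2\<close>. By the Kalman condition a suitable
  combination of these inner products with a large multiple of \<open>\<parallel>U\<parallel>\<^sup>2 + \<parallel>D U\<parallel>\<^sup>2\<close> is a Lyapunov function that
  dissipates \<open>\<parallel>D U\<parallel>\<^sup>2\<close>. Adding \<open>t \<parallel>D U\<parallel>\<^sup>2\<close> to it keeps it decreasing, which gives the decay of \<open>D U\<close>;
  the damped component \<open>U\<^sub>2\<close> then solves a damped equation with source of size \<open>\<parallel>D U\<parallel>\<close>.\<close>

section \<open>The Hilbert space of square-summable sequences\<close>

lemma l2h_dominated:
  assumes "(\<lambda>n. g n) summable_on UNIV" and "\<And>n. (norm (v n))\<^sup>2 \<le> g n"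
  shows "v \<in> l2h"
  unfolding l2h_def mem_Collect_eq
  by (rule summable_on_comparison_test[OF assms(1)]) (use assms(2) in auto)

lemma l2h_bounded_image:
  assumes "v \<in> l2h" and "\<And>n. norm (w n) \<le> K * norm (v n)"
  shows "w \<in> l2h"
proof (rule l2h_dominated)
  show "(\<lambda>n. K\<^sup>2 * (norm (v n))\<^sup>2) summable_on UNIV"
    using assms(1) by (simp add: l2h_def summable_on_cmult_right)
  show "(norm (w n))\<^sup>2 \<le> K\<^sup>2 * (norm (v n))\<^sup>2" for n
    using power_mono[OF assms(2)[of n], of 2] by (simp add: power_mult_distrib)
qed

lemma l2h_zero: "(\<lambda>n. 0) \<in> l2h"
  by (simp add: l2h_def)

lemma l2h_add:
  assumes "v \<in> l2h" "w \<in> l2h"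
  shows "(\<lambda>n. v n + w n) \<in> l2h"
proof (rule l2h_dominated)
  show "(\<lambda>n. 2 * (norm (v n))\<^sup>2 + 2 * (norm (w n))\<^sup>2) summable_on UNIV"
    using assms by (auto simp add: l2h_def intro!: summable_on_add summable_on_cmult_right)
  show "(norm (v n + w n))\<^sup>2 \<le> 2 * (norm (v n))\<^sup>2 + 2 * (norm (w n))\<^sup>2" for n
  proof -
    have "(norm (v n + w n))\<^sup>2 \<le> (norm (v n) + norm (w n))\<^sup>2"
      by (intro power_mono norm_triangle_ineq) auto
    also have "\<dots> \<le> 2 * (norm (v n))\<^sup>2 + 2 * (norm (w n))\<^sup>2"
      using sum_squares_bound[of "norm (v n)" "norm (w n)"] by (simp add: power2_sum)
    finally show ?thesis .
  qed
qed

lemma l2h_scaleR: "v \<in> l2h \<Longrightarrow> (\<lambda>n. c *\<^sub>R v n) \<in> l2h"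
  by (erule l2h_bounded_image[where K = "\<bar>c\<bar>"]) simp

lemma l2h_diff: "v \<in> l2h \<Longrightarrow> w \<in> l2h \<Longrightarrow> (\<lambda>n. v n - w n) \<in> l2h"
  using l2h_add[of v "\<lambda>n. (-1) *\<^sub>R w n"] l2h_scaleR[of w "-1"] by simp

lemma bij_plus_int: "bij (\<lambda>n::int. n + k)"
  by (rule bij_betw_byWitness[where f' = "\<lambda>n. n - k"]) auto

lemma l2h_shift: "v \<in> l2h \<Longrightarrow> (\<lambda>n. v (n + k)) \<in> l2h"
  using summable_on_reindex_bij_betw[OF bij_plus_int[of k], of "\<lambda>n. (norm (v n))\<^sup>2"]
  by (simp add: l2h_def)

lemma l2h_inner_summable:
  fixes v w :: "int \<Rightarrow> 'v::real_inner"
  assumes "v \<in> l2h" "w \<in> l2h"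
  shows "(\<lambda>n. v n \<bullet> w n) summable_on UNIV"
proof (rule Infinite_Sum.abs_summable_summable, rule Infinite_Sum.abs_summable_on_comparison_test')
  show "(\<lambda>n. (norm (v n))\<^sup>2 + (norm (w n))\<^sup>2) summable_on UNIV"
    using assms by (auto simp add: l2h_def intro!: summable_on_add)
  show "norm (v n \<bullet> w n) \<le> (norm (v n))\<^sup>2 + (norm (w n))\<^sup>2" for n
  proof -
    have "\<bar>v n \<bullet> w n\<bar> \<le> norm (v n) * norm (w n)"
      by (rule Cauchy_Schwarz_ineq2)
    also have "\<dots> \<le> (norm (v n))\<^sup>2 + (norm (w n))\<^sup>2"
      using sum_squares_bound[of "norm (v n)" "norm (w n)"]
        mult_nonneg_nonneg[OF norm_ge_zero norm_ge_zero, of "v n" "w n"]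
      by linarith
    finally show ?thesis by simp
  qed
qed

text \<open>The inner product carries no weight \<open>h\<close>, so one space serves all mesh
  sizes; the factor \<open>sqrt h\<close> returns only through
  \<open>l2h_norm_seq_of\<close>.\<close>

typedef (overloaded) 'v ell2 = "l2h :: (int \<Rightarrow> 'v::real_inner) set"
  morphisms seq_of Abs_ell2
  using l2h_zero by blast

setup_lifting type_definition_ell2

instantiation ell2 :: (real_inner) real_vector
begin

lift_definition zero_ell2 :: "'a ell2" is "\<lambda>n. 0" by (rule l2h_zero)
lift_definition plus_ell2 :: "'a ell2 \<Rightarrow> 'a ell2 \<Rightarrow> 'a ell2" is "\<lambda>v w n. v n + w n"
  by (rule l2h_add)
lift_definition minus_ell2 :: "'a ell2 \<Rightarrow> 'a ell2 \<Rightarrow> 'a ell2" is "\<lambda>v w n. v n - w n"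
  by (rule l2h_diff)
lift_definition scaleR_ell2 :: "real \<Rightarrow> 'a ell2 \<Rightarrow> 'a ell2" is "\<lambda>c v n. c *\<^sub>R v n"
  by (rule l2h_scaleR)
lift_definition uminus_ell2 :: "'a ell2 \<Rightarrow> 'a ell2" is "\<lambda>v n. - v n"
  using l2h_scaleR[of _ "-1"] by simp

instance
proof
  fix u v w :: "'a ell2" and r s :: real
  show "u + v + w = u + (v + w)" "u + v = v + u" "0 + u = u" "- u + u = 0" "u - v = u + - v"
    by (transfer; simp add: fun_eq_iff algebra_simps)+
  show "r *\<^sub>R (u + v) = r *\<^sub>R u + r *\<^sub>R v" "(r + s) *\<^sub>R u = r *\<^sub>R u + s *\<^sub>R u"
    "r *\<^sub>R s *\<^sub>R u = (r * s) *\<^sub>R u" "1 *\<^sub>R u = u"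
    by (transfer; simp add: fun_eq_iff algebra_simps)+
qed

end

instantiation ell2 :: (real_inner) real_inner
begin

lift_definition inner_ell2 :: "'a ell2 \<Rightarrow> 'a ell2 \<Rightarrow> real" is "\<lambda>v w. \<Sum>\<^sub>\<infinity>n. v n \<bullet> w n" .
definition norm_ell2 :: "'a ell2 \<Rightarrow> real" where "norm_ell2 v = sqrt (v \<bullet> v)"
definition sgn_ell2 :: "'a ell2 \<Rightarrow> 'a ell2" where "sgn_ell2 v = v /\<^sub>R norm v"
definition dist_ell2 :: "'a ell2 \<Rightarrow> 'a ell2 \<Rightarrow> real" where "dist_ell2 v w = norm (v - w)"
definition uniformity_ell2 :: "('a ell2 \<times> 'a ell2) filter"
  where "uniformity_ell2 = (INF e\<in>{0 <..}. principal {(x, y). dist x y < e})"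
definition open_ell2 :: "'a ell2 set \<Rightarrow> bool"
  where "open_ell2 S = (\<forall>x\<in>S. \<forall>\<^sub>F (x', y) in uniformity. x' = x \<longrightarrow> y \<in> S)"

instance
proof
  fix u v w :: "'a ell2" and r :: real
  show "dist u v = norm (u - v)" by (rule dist_ell2_def)
  show "sgn u = u /\<^sub>R norm u" by (rule sgn_ell2_def)
  show "(uniformity :: ('a ell2 \<times> 'a ell2) filter)
      = (INF e\<in>{0 <..}. principal {(x, y). dist x y < e})"
    by (rule uniformity_ell2_def)
  show "open S = (\<forall>x\<in>S. \<forall>\<^sub>F (x', y) in uniformity. x' = x \<longrightarrow> y \<in> S)" for S :: "'a ell2 set"
    by (rule open_ell2_def)
  show "u \<bullet> v = v \<bullet> u"
    by transfer (simp add: inner_commute)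
  show "(u + v) \<bullet> w = u \<bullet> w + v \<bullet> w"
    by transfer (simp add: inner_add_left infsum_add l2h_inner_summable)
  show "(r *\<^sub>R u) \<bullet> v = r * (u \<bullet> v)"
    by transfer (simp add: infsum_cmult_right')
  show "0 \<le> u \<bullet> u"
    by transfer (simp add: infsum_nonneg)
  show "(u \<bullet> u = 0) = (u = 0)"
  proof transfer
    fix u :: "int \<Rightarrow> 'a" assume u: "u \<in> l2h"
    show "((\<Sum>\<^sub>\<infinity>n. u n \<bullet> u n) = 0) = (u = (\<lambda>n. 0))"
    proof
      assume "(\<Sum>\<^sub>\<infinity>n. u n \<bullet> u n) = 0"
      then have "u n \<bullet> u n = 0" for n
        using nonneg_infsum_le_0D[OF _ l2h_inner_summable[OF u u], of n] by simp
      then show "u = (\<lambda>n. 0)" by (simp add: fun_eq_iff)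
    qed simp
  qed
  show "norm u = sqrt (u \<bullet> u)" by (rule norm_ell2_def)
qed

end

lemma l2h_norm_seq_of: "h > 0 \<Longrightarrow> l2h_norm h (seq_of u) = sqrt h * norm u"
  by (simp add: l2h_norm_def norm_ell2_def inner_ell2.rep_eq real_sqrt_mult dot_square_norm)

section \<open>Shifts, central differences and matrices as bounded operators\<close>

lift_definition shift :: "int \<Rightarrow> 'v::real_inner ell2 \<Rightarrow> 'v ell2" is "\<lambda>k v n. v (n + k)"
  by (rule l2h_shift)

text \<open>Reindexing the sum by a translation makes opposite shifts adjoint to each other; since
  they are also inverse, shifts are isometries.\<close>

lemma inner_shift_left: "shift k u \<bullet> v = u \<bullet> shift (- k) v"
proof -
  have "(\<Sum>\<^sub>\<infinity>n. seq_of u (n + k) \<bullet> seq_of v n)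
      = (\<Sum>\<^sub>\<infinity>n. seq_of u (n + k) \<bullet> seq_of v (n + k + - k))"
    by simp
  also have "\<dots> = (\<Sum>\<^sub>\<infinity>n. seq_of u n \<bullet> seq_of v (n + - k))"
    using infsum_reindex_bij_betw[OF bij_plus_int[of k]] .
  finally show ?thesis by (simp add: inner_ell2.rep_eq shift.rep_eq)
qed

lemma shift_shift: "shift k (shift l u) = shift (k + l) u"
  by transfer (simp add: fun_eq_iff algebra_simps)

lemma shift_0: "shift 0 u = u"
  by transfer simp

lemma norm_shift: "norm (shift k u) = norm u"
  by (simp add: norm_eq_sqrt_inner inner_shift_left shift_shift shift_0)

lemma bounded_linear_shift: "bounded_linear (shift k)"
proof (rule bounded_linear_intro[where K = 1])
  show "shift k (u + v) = shift k u + shift k v" for u v :: "'a ell2"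
    by transfer simp
  show "shift k (r *\<^sub>R u) = r *\<^sub>R shift k u" for r and u :: "'a ell2"
    by transfer simp
qed (simp add: norm_shift)

definition central_diff :: "real \<Rightarrow> 'v::real_inner ell2 \<Rightarrow> 'v ell2" where
  "central_diff h u = (shift 1 u - shift (- 1) u) /\<^sub>R (2 * h)"

lemma seq_of_central_diff: "seq_of (central_diff h u) = Dh h (seq_of u)"
  by (simp add: central_diff_def Dh_def fun_eq_iff scaleR_ell2.rep_eq minus_ell2.rep_eq shift.rep_eq)

lemma bounded_linear_central_diff: "bounded_linear (central_diff h)"
  unfolding central_diff_def
  by (intro bounded_linear_const_scaleR bounded_linear_sub bounded_linear_shift)

text \<open>The two shifts in the difference are adjoint to each other, so passing to the adjoint
  swaps them and flips the sign.\<close>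

lemma central_diff_skew: "central_diff h u \<bullet> v = - (u \<bullet> central_diff h v)"
  by (simp add: central_diff_def inner_diff_left inner_diff_right inner_shift_left algebra_simps)

lift_definition map_matrix :: "real^'n^'m \<Rightarrow> (real^'n) ell2 \<Rightarrow> (real^'m) ell2"
  is "\<lambda>M v n. M *v v n"
  by (rule l2h_bounded_image, assumption) (rule onorm[OF matrix_vector_mul_bounded_linear])

text \<open>This lifts pointwise matrix inequalities to sequences. Both sides are inner products
  because these are always summable; constants enter by scaling one factor.\<close>

lemma inner_ell2_mono:
  assumes "\<And>n. seq_of u n \<bullet> seq_of v n \<le> seq_of w n \<bullet> seq_of z n"
  shows "u \<bullet> v \<le> w \<bullet> z"
  unfolding inner_ell2.rep_eq by (intro infsum_mono l2h_inner_summable seq_of assms)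

lemma norm_ell2_mono:
  assumes "\<And>n. norm (seq_of u n) \<le> K * norm (seq_of v n)" and "0 \<le> K"
  shows "norm u \<le> K * norm v"
proof -
  have "u \<bullet> u \<le> (K *\<^sub>R v) \<bullet> (K *\<^sub>R v)"
  proof (rule inner_ell2_mono)
    show "seq_of u n \<bullet> seq_of u n \<le> seq_of (K *\<^sub>R v) n \<bullet> seq_of (K *\<^sub>R v) n" for n
      using power_mono[OF assms(1)[of n], of 2] assms(2)
      by (simp only: dot_square_norm scaleR_ell2.rep_eq norm_scaleR abs_of_nonneg norm_ge_zero)
  qed
  then have "(norm u)\<^sup>2 \<le> (K * norm v)\<^sup>2"
    using assms(2) by (simp only: dot_square_norm norm_scaleR abs_of_nonneg)
  then show ?thesis
    by (rule power2_le_imp_le) (simp add: assms(2))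
qed

lemma map_matrix_mult: "map_matrix M (map_matrix N u) = map_matrix (M ** N) u"
  by transfer (simp add: fun_eq_iff matrix_vector_mul_assoc)

lemma map_matrix_mat_1: "map_matrix (mat 1) u = u"
  by transfer simp

lemma map_matrix_power: "(map_matrix A ^^ k) u = map_matrix (matrix_power A k) u"
  by (induction k) (simp_all add: map_matrix_mat_1 map_matrix_mult)

lemma inner_map_matrix_left: "map_matrix M u \<bullet> v = u \<bullet> map_matrix (transpose M) v"
proof -
  have "(M *v x) \<bullet> y = x \<bullet> (transpose M *v y)" for x y
    by (metis dot_lmul_matrix inner_commute transpose_matrix_vector)
  then show ?thesis by transfer simp
qed

lemma bounded_linear_map_matrix: "bounded_linear (map_matrix M)"
proof (rule bounded_linear_intro)
  fix u v :: "(real^'a) ell2" and r :: real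
  show "map_matrix M (u + v) = map_matrix M u + map_matrix M v"
    by transfer (simp add: matrix_vector_right_distrib)
  show "map_matrix M (r *\<^sub>R u) = r *\<^sub>R map_matrix M u"
    by transfer (simp add: matrix_vector_mult_scaleR)
  show "norm (map_matrix M u) \<le> norm u * onorm ((*v) M)"
    using norm_ell2_mono[of "map_matrix M u" "onorm ((*v) M)" u]
    by (simp add: map_matrix.rep_eq onorm onorm_pos_le matrix_vector_mul_bounded_linear mult.commute)
qed

lemma map_matrix_central_diff: "map_matrix M (central_diff h u) = central_diff h (map_matrix M u)"
proof -
  have "seq_of (map_matrix M (central_diff h u)) n = seq_of (central_diff h (map_matrix M u)) n" for n
    by (simp add: map_matrix.rep_eq seq_of_central_diff Dh_def matrix_vector_mult_scaleR
      matrix_vector_mult_diff_distrib)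
  then show ?thesis by (metis ext seq_of_inject)
qed

section \<open>Hypocoercivity of an abstract partially dissipative flow\<close>

text \<open>Mean value theorem. The derivative is taken within the closed half-line, so at 0 it is
  only the one-sided derivative that \<open>C1_l2h\<close> provides.\<close>

lemma nonincreasing_from_0:
  fixes f f' :: "real \<Rightarrow> real"
  assumes "\<And>t. t \<ge> 0 \<Longrightarrow> (f has_real_derivative f' t) (at t within {0..})"
    and "\<And>t. t \<ge> 0 \<Longrightarrow> f' t \<le> 0" and "t \<ge> 0"
  shows "f t \<le> f 0"
proof (cases "t = 0")
  case False
  have "\<exists>s\<in>{0<..<t}. f t - f 0 = f' s * (t - 0)"
  proof (rule mvt_simple)
    show "0 < t" using False assms(3) by simp
    show "(f has_derivative (*) (f' s)) (at s within {0..t})" if "0 \<le> s" "s \<le> t" for s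
      using has_field_derivative_subset[OF assms(1)[OF that(1)], of "{0..t}"]
      by (auto simp: has_field_derivative_def)
  qed
  then obtain s where "s \<in> {0<..<t}" "f t - f 0 = f' s * t" by auto
  then show ?thesis
    using mult_nonneg_nonneg[of "- f' s" t] assms(2)[of s] assms(3) by auto
qed simp

text \<open>Young's inequality with weight \<open>r\<close>, by completing the square.\<close>

lemma two_mult_le_weighted_squares:
  fixes x y r :: real
  assumes "r > 0"
  shows "2 * x * y \<le> r * x\<^sup>2 + y\<^sup>2 / r"
proof -
  have "0 \<le> (r * x - y)\<^sup>2 / r"
    using assms by simp
  also have "\<dots> = r * x\<^sup>2 + y\<^sup>2 / r - 2 * x * y"
    using assms by (simp add: power2_eq_square field_simps)
  finally show ?thesis by simp
qed

section \<open>The abstract setting: symmetric transport, partial damping, observability\<close>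

text \<open>The difference operator is deliberately not fixed here: the estimates quantify over it
  after their constants, which makes these independent of the mesh. \<open>dissipative\<close>
  bounds the damping from above by \<open>1 / \<kappa>\<close>, and \<open>spectral_gap\<close>
  keeps its spectrum out of the interval from 0 to \<open>\<kappa>\<close> while allowing a
  kernel.\<close>

locale kalman_dissipative =
  fixes a b :: "'h::real_inner \<Rightarrow> 'h" and N :: nat and \<kappa> K :: real
  assumes bounded_linear_a: "bounded_linear a"
    and bounded_linear_b: "bounded_linear b"
    and a_sym: "a x \<bullet> y = x \<bullet> a y"
    and b_sym: "b x \<bullet> y = x \<bullet> b y"
    and \<kappa>_pos: "\<kappa> > 0"
    and dissipative: "\<kappa> * (norm (b x))\<^sup>2 \<le> b x \<bullet> x"
    and spectral_gap: "\<kappa> * (b x \<bullet> x) \<le> (norm (b x))\<^sup>2"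
    and K_pos: "K > 0"
    and kalman: "(norm x)\<^sup>2 \<le> K * (\<Sum>k<N. (norm (b ((a ^^ k) x)))\<^sup>2)"
begin

interpretation a: bounded_linear a by (rule bounded_linear_a)
interpretation b: bounded_linear b by (rule bounded_linear_b)

definition skew_commuting :: "('h \<Rightarrow> 'h) \<Rightarrow> bool" where
  "skew_commuting d \<longleftrightarrow> bounded_linear d \<and> (\<forall>x y. d x \<bullet> y = - (x \<bullet> d y)) \<and>
     (\<forall>x. d (a x) = a (d x)) \<and> (\<forall>x. d (b x) = b (d x))"

text \<open>The right-hand side of the evolution equation, not its solution map: solutions have time
  derivative \<open>flow d (u t)\<close>.\<close>

definition flow :: "('h \<Rightarrow> 'h) \<Rightarrow> 'h \<Rightarrow> 'h" where
  "flow d u = - a (d u) - b u"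

text \<open>For matrices, \<open>b a^k\<close> is the transpose of the k-th block of the Kalman
  matrix.\<close>

definition obs :: "nat \<Rightarrow> 'h \<Rightarrow> 'h" where
  "obs k x = b ((a ^^ k) x)"

lemma obs_0: "obs 0 x = b x"
  by (simp add: obs_def)

lemma obs_a: "obs k (a x) = obs (Suc k) x"
  by (simp add: obs_def funpow_swap1)

lemma bounded_linear_obs: "bounded_linear (obs k)"
proof -
  have "bounded_linear (a ^^ k)"
    by (induction k) (auto simp: id_def o_def intro: bounded_linear_compose[OF bounded_linear_a])
  then show ?thesis
    unfolding obs_def by (rule bounded_linear_compose[OF bounded_linear_b])
qed

lemma obs_skew_commuting:
  assumes "skew_commuting d"
  shows "obs k (d x) = d (obs k x)"
proof -
  have "(a ^^ k) (d x) = d ((a ^^ k) x)"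
    using assms by (induction k) (simp_all add: skew_commuting_def)
  then show ?thesis
    using assms by (simp add: obs_def skew_commuting_def)
qed

lemma d_flow: "skew_commuting d \<Longrightarrow> d (flow d u) = flow d (d u)"
  by (simp add: skew_commuting_def flow_def bounded_linear.linear linear_neg linear_diff)

text \<open>Transport conserves energy because the composition of \<^term>\<open>a\<close> with a commuting skew
  operator is skew.\<close>

lemma inner_flow:
  assumes "skew_commuting d"
  shows "u \<bullet> flow d u = - (b u \<bullet> u)"
proof -
  have "u \<bullet> a (d u) = - (u \<bullet> a (d u))"
    using assms by (metis a_sym inner_commute skew_commuting_def)
  then show ?thesis
    by (simp add: flow_def inner_diff_right inner_commute)
qed

section \<open>Cross terms and the control of the differences by the damped quantities\<close>

definition cross :: "nat \<Rightarrow> ('h \<Rightarrow> 'h) \<Rightarrow> 'h \<Rightarrow> real" where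
  "cross j d u = obs j u \<bullet> obs (Suc j) (d u)"

text \<open>The time derivative of \<open>cross j d\<close> along a solution, by the product
  rule.\<close>

definition cross_rate :: "nat \<Rightarrow> ('h \<Rightarrow> 'h) \<Rightarrow> 'h \<Rightarrow> real" where
  "cross_rate j d u = obs j u \<bullet> obs (Suc j) (d (flow d u)) + obs j (flow d u) \<bullet> obs (Suc j) (d u)"

text \<open>In the first product, skewness moves the outer \<open>d\<close> to the other factor, so
  no second difference of \<open>u\<close> survives. The negative square comes from the transport
  term in \<open>obs j (flow d u)\<close>.\<close>

lemma cross_rate_eq:
  assumes d: "skew_commuting d"
  shows "cross_rate j d u = - (norm (obs (Suc j) (d u)))\<^sup>2 + obs j (d u) \<bullet> obs (Suc (Suc j)) (d u)
    + obs j (d u) \<bullet> obs (Suc j) (b u) - obs j (b u) \<bullet> obs (Suc j) (d u)"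
proof -
  have skew: "x \<bullet> d y = - (d x \<bullet> y)" for x y
    using d by (simp add: skew_commuting_def)
  have flow: "obs k (flow d v) = - obs (Suc k) (d v) - obs k (b v)" for k v
    by (simp add: flow_def obs_a linear_neg linear_diff bounded_linear.linear[OF bounded_linear_obs])
  have "obs j u \<bullet> obs (Suc j) (d (flow d u)) = - (d (obs j u) \<bullet> obs (Suc j) (flow d u))"
    by (simp only: obs_skew_commuting[OF d] skew)
  also have "\<dots> = obs j (d u) \<bullet> (obs (Suc (Suc j)) (d u) + obs (Suc j) (b u))"
    by (simp add: flow obs_skew_commuting[OF d, symmetric] inner_diff_right inner_add_right)
  finally show ?thesis
    by (simp add: cross_rate_def flow inner_add_right inner_diff_left dot_square_norm)
qed

lemma obs_bound: "\<exists>C\<ge>0. \<forall>x. norm (obs k x) \<le> C * norm x"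
  using onorm[OF bounded_linear_obs] onorm_pos_le[OF bounded_linear_obs] by blast

text \<open>All inner products are bounded by Cauchy-Schwarz. The one pairing
  \<open>obs (Suc j) (d u)\<close> with \<open>b u\<close> costs half of the square on the left;
  restoring that half produces the factor 2 before \<open>cross_rate\<close>.\<close>

lemma cross_rate_bound:
  "\<exists>C\<ge>0. \<forall>d u. skew_commuting d \<longrightarrow> (norm (obs (Suc j) (d u)))\<^sup>2 \<le>
     - 2 * cross_rate j d u + C * norm (obs j (d u)) * (norm (d u) + norm (b u)) + C * (norm (b u))\<^sup>2"
proof -
  obtain C0 where C0: "C0 \<ge> 0" "\<And>x. norm (obs j x) \<le> C0 * norm x" using obs_bound by metis
  obtain C1 where C1: "C1 \<ge> 0" "\<And>x. norm (obs (Suc j) x) \<le> C1 * norm x" using obs_bound by metis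
  obtain C2 where C2: "C2 \<ge> 0" "\<And>x. norm (obs (Suc (Suc j)) x) \<le> C2 * norm x"
    using obs_bound by metis
  define C where "C = C0\<^sup>2 + 2 * C1 + 2 * C2"
  have "(norm (obs (Suc j) (d u)))\<^sup>2 \<le>
     - 2 * cross_rate j d u + C * norm (obs j (d u)) * (norm (d u) + norm (b u)) + C * (norm (b u))\<^sup>2"
    if d: "skew_commuting d" for d u
  proof -
    define X Y s y where "X = norm (obs j (d u))" and "Y = norm (obs (Suc j) (d u))"
      and "s = norm (d u)" and "y = norm (b u)"
    note defs = X_def Y_def s_def y_def
    have pos: "X \<ge> 0" "Y \<ge> 0" "s \<ge> 0" "y \<ge> 0" by (simp_all add: defs)
    have "obs j (d u) \<bullet> obs (Suc (Suc j)) (d u) \<le> X * (C2 * s)"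
      using order_trans[OF norm_cauchy_schwarz mult_left_mono[OF C2(2) norm_ge_zero]]
      by (simp add: defs)
    moreover have "obs j (d u) \<bullet> obs (Suc j) (b u) \<le> X * (C1 * y)"
      using order_trans[OF norm_cauchy_schwarz mult_left_mono[OF C1(2) norm_ge_zero]]
      by (simp add: defs)
    moreover have "- (obs j (b u) \<bullet> obs (Suc j) (d u)) \<le> (C0 * y) * Y"
      using order_trans[OF Cauchy_Schwarz_ineq2 mult_right_mono[OF C0(2) norm_ge_zero],
          of "b u" "obs (Suc j) (d u)"]
      unfolding defs by linarith
    moreover have "2 * (C0 * y) * Y \<le> (C0 * y)\<^sup>2 + Y\<^sup>2"
      by (rule sum_squares_bound)
    ultimately have "Y\<^sup>2 \<le> - 2 * cross_rate j d u + 2 * (X * (C2 * s)) + 2 * (X * (C1 * y)) + (C0 * y)\<^sup>2"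
      unfolding cross_rate_eq[OF d] Y_def[symmetric] by (simp add: algebra_simps)
    also have "\<dots> \<le> - 2 * cross_rate j d u + C * X * (s + y) + C * y\<^sup>2"
    proof -
      have "C * X * (s + y) + C * y\<^sup>2 - (2 * (X * (C2 * s)) + 2 * (X * (C1 * y)) + (C0 * y)\<^sup>2)
        = (C0\<^sup>2 + 2 * C1) * (X * s) + (C0\<^sup>2 + 2 * C2) * (X * y) + (2 * C1 + 2 * C2) * y\<^sup>2"
        by (simp add: C_def algebra_simps power_mult_distrib)
      also have "\<dots> \<ge> 0" using pos C0 C1 C2 by simp
      finally show ?thesis by simp
    qed
    finally show ?thesis by (simp add: defs)
  qed
  moreover have "C \<ge> 0" using C0 C1 C2 by (simp add: C_def)
  ultimately show ?thesis by blast
qed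

text \<open>By \<open>dissipative\<close>, the energy of \<open>u\<close> and \<open>d u\<close> is
  lost at a rate of at least \<open>2 * \<kappa>\<close> times this quantity.\<close>

definition damped :: "('h \<Rightarrow> 'h) \<Rightarrow> 'h \<Rightarrow> real" where
  "damped d u = (norm (b u))\<^sup>2 + (norm (b (d u)))\<^sup>2"

text \<open>The factor \<^term>\<open>\<delta>\<close> can be made as small as we like because each step trades
  the next observation, bounded by \<^term>\<open>norm (d u)\<close>, against a large multiple of the previous one.\<close>

lemma obs_controlled:
  assumes "k \<le> N" "\<delta> > 0"
  shows "\<exists>\<epsilon> C. C \<ge> 0 \<and> (\<forall>d u. skew_commuting d \<longrightarrow> (norm (obs k (d u)))\<^sup>2 \<le>
     \<delta> * (norm (d u))\<^sup>2 + C * damped d u - (\<Sum>j<N. \<epsilon> j * cross_rate j d u))"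
  using assms
proof (induction k arbitrary: \<delta>)
  case 0
  \<comment> \<open>The observation of order 0 is \<open>b (d u)\<close>, itself part of
    \<open>damped\<close>, so all weights can vanish.\<close>
  have "(norm (obs 0 (d u)))\<^sup>2 \<le>
     \<delta> * (norm (d u))\<^sup>2 + 1 * damped d u - (\<Sum>j<N. 0 * cross_rate j d u)" for d u
    using 0 by (simp add: obs_0 damped_def)
  then show ?case by (intro exI[of _ "\<lambda>_. 0"] exI[of _ 1]) auto
next
  case (Suc k)
  obtain C where C: "C \<ge> 0" "\<And>d u. skew_commuting d \<Longrightarrow> (norm (obs (Suc k) (d u)))\<^sup>2 \<le>
     - 2 * cross_rate k d u + C * norm (obs k (d u)) * (norm (d u) + norm (b u)) + C * (norm (b u))\<^sup>2"
    using cross_rate_bound by metis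
  \<comment> \<open>The total coefficient of \<open>X^2\<close> produced by the Young inequalities
    \<open>1\<close> and \<open>2\<close> below.\<close>
  define R where "R = C\<^sup>2 / \<delta> + 1"
  have R: "R > 0" using Suc.prems by (simp add: R_def add_nonneg_pos)
  \<comment> \<open>Multiplication by \<open>R\<close> turns this smaller parameter into
    \<open>\<delta> / 2\<close>; the other half of \<open>\<delta>\<close> is spent in inequality
    \<open>1\<close>.\<close>
  obtain \<epsilon> C' where C': "C' \<ge> 0" "\<And>d u. skew_commuting d \<Longrightarrow> (norm (obs k (d u)))\<^sup>2 \<le>
     \<delta> / (2 * R) * (norm (d u))\<^sup>2 + C' * damped d u - (\<Sum>j<N. \<epsilon> j * cross_rate j d u)"
    using Suc.IH[of "\<delta> / (2 * R)"] Suc.prems R by auto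
  \<comment> \<open>The old weights are scaled by \<open>R\<close>, and the new cross term enters
    with the factor 2 of \<open>cross_rate_bound\<close>; its index is in range because
    \<open>Suc k \<le> N\<close>.\<close>
  define \<epsilon>' where "\<epsilon>' j = R * \<epsilon> j + (if j = k then 2 else 0)" for j
  have "(norm (obs (Suc k) (d u)))\<^sup>2 \<le>
     \<delta> * (norm (d u))\<^sup>2 + (R * C' + C\<^sup>2 + C) * damped d u - (\<Sum>j<N. \<epsilon>' j * cross_rate j d u)"
    if d: "skew_commuting d" for d u
  proof -
    define X s y where "X = norm (obs k (d u))" and "s = norm (d u)" and "y = norm (b u)"
    have sum: "(\<Sum>j<N. \<epsilon>' j * cross_rate j d u)
      = R * (\<Sum>j<N. \<epsilon> j * cross_rate j d u) + 2 * cross_rate k d u"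
    proof -
      have "(\<Sum>j<N. (if j = k then 2 else 0) * cross_rate j d u) = 2 * cross_rate k d u"
        using Suc.prems by (subst sum.remove[of _ k]) auto
      then show ?thesis
        by (simp add: \<epsilon>'_def distrib_right sum.distrib sum_distrib_left mult.assoc)
    qed
    have 1: "C * X * s \<le> (\<delta> / 2) * s\<^sup>2 + C\<^sup>2 / \<delta> * X\<^sup>2"
    proof -
      have "(C * X)\<^sup>2 / \<delta> \<ge> 0" using Suc.prems by simp
      moreover have "(C * X)\<^sup>2 / \<delta> = C\<^sup>2 / \<delta> * X\<^sup>2" by (simp add: power_mult_distrib)
      ultimately show ?thesis
        using two_mult_le_weighted_squares[of \<delta> s "C * X"] Suc.prems(2) by argo
    qed
    have 2: "C * X * y \<le> X\<^sup>2 + C\<^sup>2 * y\<^sup>2"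
    proof -
      have "2 * (C * X * y) \<le> X\<^sup>2 + C\<^sup>2 * y\<^sup>2"
        using sum_squares_bound[of X "C * y"] by (simp add: power_mult_distrib mult_ac)
      moreover have "X\<^sup>2 + C\<^sup>2 * y\<^sup>2 \<ge> 0" by simp
      ultimately show ?thesis by linarith
    qed
    have 3: "R * X\<^sup>2 \<le> \<delta> / 2 * s\<^sup>2 + R * C' * damped d u - R * (\<Sum>j<N. \<epsilon> j * cross_rate j d u)"
      using mult_left_mono[OF C'(2)[OF d, of u] less_imp_le[OF R]] R
      by (simp add: algebra_simps X_def s_def)
    have 4: "(C\<^sup>2 + C) * y\<^sup>2 \<le> (C\<^sup>2 + C) * damped d u"
      using C(1) by (intro mult_left_mono) (auto simp: damped_def y_def)
    have "(norm (obs (Suc k) (d u)))\<^sup>2 \<le> - 2 * cross_rate k d u + C * X * (s + y) + C * y\<^sup>2"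
      using C(2)[OF d, of u] by (simp add: X_def s_def y_def)
    also have "\<dots> \<le> - 2 * cross_rate k d u + \<delta> / 2 * s\<^sup>2 + R * X\<^sup>2 + (C\<^sup>2 + C) * y\<^sup>2"
      using 1 2 by (simp add: R_def algebra_simps)
    also have "\<dots> \<le> \<delta> * s\<^sup>2 + (R * C' + C\<^sup>2 + C) * damped d u - (\<Sum>j<N. \<epsilon>' j * cross_rate j d u)"
      using 3 4 unfolding sum by (simp add: algebra_simps)
    finally show ?thesis by (simp add: s_def)
  qed
  moreover have "R * C' + C\<^sup>2 + C \<ge> 0" using R C C' by simp
  ultimately show ?case by blast
qed

text \<open>Summing \<open>obs_controlled\<close> over all orders and applying the Kalman inequality
  leaves a small multiple of the left side, which is absorbed.\<close>

lemma derivative_controlled: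
  "\<exists>\<epsilon> C. C \<ge> 0 \<and> (\<forall>d u. skew_commuting d \<longrightarrow>
     (norm (d u))\<^sup>2 \<le> C * damped d u - (\<Sum>j<N. \<epsilon> j * cross_rate j d u))"
proof -
  \<comment> \<open>Chosen so that \<open>K * N * \<delta> \<le> 1 / 2\<close>; absorbing that half
    doubles the remaining constants. The \<open>+ 1\<close> keeps the denominator positive even for
    \<open>N = 0\<close>.\<close>
  define \<delta> where "\<delta> = 1 / (2 * K * (real N + 1))"
  have \<delta>: "\<delta> > 0" using K_pos by (simp add: \<delta>_def)
  define P where "P k \<epsilon> C \<longleftrightarrow> C \<ge> 0 \<and> (\<forall>d u. skew_commuting d \<longrightarrow> (norm (obs k (d u)))\<^sup>2 \<le>
     \<delta> * (norm (d u))\<^sup>2 + C * damped d u - (\<Sum>j<N. \<epsilon> j * cross_rate j d u))"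
    for k and \<epsilon> :: "nat \<Rightarrow> real" and C
  have "\<exists>\<epsilon> C. P k \<epsilon> C" if "k < N" for k
    using obs_controlled[of k, OF _ \<delta>] that unfolding P_def by simp
  then obtain \<epsilon> C where P: "\<And>k. k < N \<Longrightarrow> P k (\<epsilon> k) (C k)"
    by metis
  have C: "\<And>k. k < N \<Longrightarrow> C k \<ge> 0"
    "\<And>k d u. k < N \<Longrightarrow> skew_commuting d \<Longrightarrow> (norm (obs k (d u)))\<^sup>2 \<le>
     \<delta> * (norm (d u))\<^sup>2 + C k * damped d u - (\<Sum>j<N. \<epsilon> k j * cross_rate j d u)"
    using P unfolding P_def by blast+
  have bound: "(norm (d u))\<^sup>2 \<le> (2 * K * (\<Sum>k<N. C k)) * damped d u
      - (\<Sum>j<N. (2 * K * (\<Sum>k<N. \<epsilon> k j)) * cross_rate j d u)"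
    if d: "skew_commuting d" for d u
  proof -
    define S where "S = (\<Sum>k<N. \<Sum>j<N. \<epsilon> k j * cross_rate j d u)"
    have S: "(\<Sum>j<N. (2 * K * (\<Sum>k<N. \<epsilon> k j)) * cross_rate j d u) = 2 * K * S"
      unfolding S_def by (subst sum.swap) (simp add: sum_distrib_left sum_distrib_right mult.assoc)
    have "(norm (d u))\<^sup>2 \<le> K * (\<Sum>k<N. (norm (obs k (d u)))\<^sup>2)"
      using kalman by (simp add: obs_def)
    also have "\<dots> \<le> K * (\<Sum>k<N. \<delta> * (norm (d u))\<^sup>2 + C k * damped d u
        - (\<Sum>j<N. \<epsilon> k j * cross_rate j d u))"
      using K_pos C(2)[OF _ d] by (intro mult_left_mono sum_mono) auto
    also have "\<dots> = K * real N * \<delta> * (norm (d u))\<^sup>2 + K * (\<Sum>k<N. C k) * damped d u - K * S"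
      by (simp add: S_def sum.distrib sum_subtractf sum_distrib_right algebra_simps)
    also have "K * real N * \<delta> * (norm (d u))\<^sup>2 \<le> 1 / 2 * (norm (d u))\<^sup>2"
    proof (rule mult_right_mono)
      have "K * real N * \<delta> = real N / (2 * (real N + 1))"
        using K_pos by (simp add: \<delta>_def)
      also have "\<dots> \<le> 1 / 2" by (simp add: field_simps)
      finally show "K * real N * \<delta> \<le> 1 / 2" .
    qed simp
    finally show ?thesis unfolding S by simp
  qed
  show ?thesis
  proof (intro exI conjI allI impI)
    show "2 * K * (\<Sum>k<N. C k) \<ge> 0"
      using K_pos C(1) by (auto intro!: mult_nonneg_nonneg sum_nonneg)
  qed (rule bound)
qed

text \<open>A large enough multiple of the energy therefore dominates any fixed combination of cross
  terms.\<close>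

lemma cross_bound:
  "\<exists>C\<ge>0. \<forall>d u. \<bar>\<Sum>j<N. \<epsilon> j * cross j d u\<bar> \<le> C * ((norm u)\<^sup>2 + (norm (d u))\<^sup>2)"
proof -
  obtain C where C: "\<And>j. C j \<ge> 0" "\<And>j x. norm (obs j x) \<le> C j * norm x"
    using obs_bound by metis
  have bound: "\<bar>cross j d u\<bar> \<le> C j * C (Suc j) * ((norm u)\<^sup>2 + (norm (d u))\<^sup>2)" for j d u
  proof -
    have "\<bar>cross j d u\<bar> \<le> norm (obs j u) * norm (obs (Suc j) (d u))"
      unfolding cross_def by (rule Cauchy_Schwarz_ineq2)
    also have "\<dots> \<le> (C j * norm u) * (C (Suc j) * norm (d u))"
      using C by (intro mult_mono) (auto intro: mult_nonneg_nonneg)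
    also have "\<dots> = C j * C (Suc j) * (norm u * norm (d u))" by simp
    also have "\<dots> \<le> C j * C (Suc j) * ((norm u)\<^sup>2 + (norm (d u))\<^sup>2)"
    proof (intro mult_left_mono mult_nonneg_nonneg C)
      show "norm u * norm (d u) \<le> (norm u)\<^sup>2 + (norm (d u))\<^sup>2"
        using sum_squares_bound[of "norm u" "norm (d u)"]
          mult_nonneg_nonneg[OF norm_ge_zero norm_ge_zero, of u "d u"] by linarith
    qed
    finally show ?thesis .
  qed
  have "\<bar>\<Sum>j<N. \<epsilon> j * cross j d u\<bar> \<le> (\<Sum>j<N. \<bar>\<epsilon> j\<bar> * (C j * C (Suc j))) * ((norm u)\<^sup>2 + (norm (d u))\<^sup>2)"
    for d u
  proof -
    have "\<bar>\<Sum>j<N. \<epsilon> j * cross j d u\<bar> \<le> (\<Sum>j<N. \<bar>\<epsilon> j\<bar> * \<bar>cross j d u\<bar>)"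
      by (rule order_trans[OF sum_abs]) (simp add: abs_mult)
    also have "\<dots> \<le> (\<Sum>j<N. \<bar>\<epsilon> j\<bar> * (C j * C (Suc j) * ((norm u)\<^sup>2 + (norm (d u))\<^sup>2)))"
      by (intro sum_mono mult_left_mono bound) auto
    finally show ?thesis by (simp add: sum_distrib_right mult.assoc)
  qed
  moreover have "(\<Sum>j<N. \<bar>\<epsilon> j\<bar> * (C j * C (Suc j))) \<ge> 0"
    using C(1) by (intro sum_nonneg mult_nonneg_nonneg) auto
  ultimately show ?thesis by blast
qed

section \<open>Decay along solutions\<close>

text \<open>One product rule, specialised below to both energies, to the cross terms and to the
  damped form \<open>b u \<bullet> u\<close>.\<close>

lemma deriv_inner_flow:
  assumes d: "skew_commuting d"
    and u: "(u has_vector_derivative flow d (u t)) (at t within S)"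
    and f: "bounded_linear f" and g: "bounded_linear g"
  shows "((\<lambda>t. f (u t) \<bullet> g (u t)) has_real_derivative
    f (u t) \<bullet> g (flow d (u t)) + f (flow d (u t)) \<bullet> g (u t)) (at t within S)"
  unfolding has_real_derivative_iff_has_vector_derivative
  by (rule bounded_bilinear.has_vector_derivative[OF bounded_bilinear_inner
        bounded_linear.has_vector_derivative[OF f u] bounded_linear.has_vector_derivative[OF g u]])

lemma derivative_decay:
  "\<exists>C\<ge>0. \<forall>d u. skew_commuting d \<longrightarrow>
     (\<forall>t\<ge>0. (u has_vector_derivative flow d (u t)) (at t within {0..})) \<longrightarrow>
     (\<forall>t\<ge>0. (1 + t) * (norm (d (u t)))\<^sup>2 \<le> C * ((norm (u 0))\<^sup>2 + (norm (d (u 0)))\<^sup>2))"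
proof -
  obtain \<epsilon> C where C: "C \<ge> 0" "\<And>d u. skew_commuting d \<Longrightarrow>
     (norm (d u))\<^sup>2 \<le> C * damped d u - (\<Sum>j<N. \<epsilon> j * cross_rate j d u)"
    using derivative_controlled by metis
  obtain C' where C': "C' \<ge> 0"
    "\<And>d u. \<bar>\<Sum>j<N. \<epsilon> j * cross j d u\<bar> \<le> C' * ((norm u)\<^sup>2 + (norm (d u))\<^sup>2)"
    using cross_bound by metis
  \<comment> \<open>The summand \<open>C'\<close> lets \<open>L * e\<close> dominate the cross
    terms; the other one lets its dissipation pay for \<open>C * damped\<close>.\<close>
  define L where "L = C / (2 * \<kappa>) + C'"
  have L: "L \<ge> C'" "C \<le> 2 * \<kappa> * L"
    using \<kappa>_pos C(1) C'(1) by (auto simp: L_def field_simps)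
  have "(1 + t) * (norm (d (u t)))\<^sup>2 \<le> (2 * L + 1) * ((norm (u 0))\<^sup>2 + (norm (d (u 0)))\<^sup>2)"
    if d: "skew_commuting d" and t: "t \<ge> 0"
      and u: "\<And>t. t \<ge> 0 \<Longrightarrow> (u has_vector_derivative flow d (u t)) (at t within {0..})" for d u t
  proof -
    have bl: "bounded_linear d" using d by (simp add: skew_commuting_def)
    define e where "e t = (norm (u t))\<^sup>2 + (norm (d (u t)))\<^sup>2" for t
    define F where "F t = (\<Sum>j<N. \<epsilon> j * cross j d (u t))" for t
    define G where "G t = (\<Sum>j<N. \<epsilon> j * cross_rate j d (u t))" for t
    have Du: "((\<lambda>t. (norm (u t))\<^sup>2) has_real_derivative - 2 * (b (u t) \<bullet> u t)) (at t within {0..})"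
      if "t \<ge> 0" for t
      using deriv_inner_flow[OF d u[OF that] bounded_linear_ident bounded_linear_ident]
      by (simp add: dot_square_norm inner_flow[OF d] inner_commute)
    \<comment> \<open>Since \<open>d\<close> commutes with \<open>flow d\<close>, \<open>d u\<close>
      solves the same equation and obeys the same energy identity.\<close>
    have Dd: "((\<lambda>t. (norm (d (u t)))\<^sup>2) has_real_derivative - 2 * (b (d (u t)) \<bullet> d (u t))) (at t within {0..})"
      if "t \<ge> 0" for t
      using deriv_inner_flow[OF d u[OF that] bl bl]
      by (simp add: dot_square_norm d_flow[OF d] inner_flow[OF d] inner_commute)
    have DF: "(F has_real_derivative G t) (at t within {0..})" if "t \<ge> 0" for t
    proof -
      have "((\<lambda>t. cross j d (u t)) has_real_derivative cross_rate j d (u t)) (at t within {0..})" for j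
        unfolding cross_def cross_rate_def
        by (rule deriv_inner_flow[OF d u[OF that] bounded_linear_obs
              bounded_linear_compose[OF bounded_linear_obs bl]])
      then show ?thesis
        unfolding F_def[abs_def] G_def by (intro DERIV_sum DERIV_cmult)
    qed
    \<comment> \<open>Differentiating the time weight costs one \<open>(norm (d (u t)))^2\<close>,
      exactly what the dissipation of the first two terms supplies.\<close>
    define \<Phi> where "\<Phi> t = L * e t + F t + t * (norm (d (u t)))\<^sup>2" for t
    define \<Phi>' where "\<Phi>' t = L * (- 2 * (b (u t) \<bullet> u t) - 2 * (b (d (u t)) \<bullet> d (u t))) + G t
      + ((norm (d (u t)))\<^sup>2 - 2 * t * (b (d (u t)) \<bullet> d (u t)))" for t
    have D\<Phi>: "(\<Phi> has_real_derivative \<Phi>' t) (at t within {0..})" if "t \<ge> 0" for t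
      unfolding \<Phi>_def[abs_def] \<Phi>'_def e_def
      by (rule derivative_eq_intros Du[OF that] Dd[OF that] DF[OF that] refl)+ (simp add: algebra_simps)
    have dissipation: "b x \<bullet> x \<ge> 0" for x
      by (rule order_trans[OF _ dissipative]) (use \<kappa>_pos in simp)
    have "\<Phi>' t \<le> 0" if "t \<ge> 0" for t
    proof -
      have "(norm (d (u t)))\<^sup>2 + G t \<le> C * damped d (u t)"
        using C(2)[OF d, of "u t"] by (simp add: G_def)
      also have "\<dots> \<le> 2 * \<kappa> * L * damped d (u t)"
        using L(2) by (intro mult_right_mono) (auto simp: damped_def)
      also have "\<dots> = 2 * L * (\<kappa> * (norm (b (u t)))\<^sup>2 + \<kappa> * (norm (b (d (u t))))\<^sup>2)"
        by (simp add: damped_def algebra_simps)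
      also have "\<dots> \<le> 2 * L * (b (u t) \<bullet> u t + b (d (u t)) \<bullet> d (u t))"
        using L(1) C'(1) by (intro mult_left_mono add_mono dissipative) auto
      finally have "(norm (d (u t)))\<^sup>2 + G t \<le> 2 * L * (b (u t) \<bullet> u t + b (d (u t)) \<bullet> d (u t))" .
      moreover have "t * (b (d (u t)) \<bullet> d (u t)) \<ge> 0"
        using that dissipation by simp
      ultimately show ?thesis by (simp add: \<Phi>'_def algebra_simps)
    qed
    then have "\<Phi> t \<le> \<Phi> 0"
      using nonincreasing_from_0[OF D\<Phi> _ t] by blast
    moreover have "t * (norm (d (u t)))\<^sup>2 \<le> \<Phi> t"
    proof -
      have "C' * e t \<le> L * e t" using L(1) by (intro mult_right_mono) (auto simp: e_def)
      then show ?thesis using C'(2)[where d = d and u = "u t"] by (simp add: \<Phi>_def F_def e_def[symmetric])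
    qed
    moreover have "\<Phi> 0 \<le> 2 * L * e 0"
    proof -
      have "C' * e 0 \<le> L * e 0" using L(1) by (intro mult_right_mono) (auto simp: e_def)
      then show ?thesis using C'(2)[where d = d and u = "u 0"] by (simp add: \<Phi>_def F_def e_def[symmetric])
    qed
    \<comment> \<open>The unweighted bound supplies the 1 in \<open>1 + t\<close> and the final
      \<open>+ 1\<close> in the constant \<open>2 * L + 1\<close>.\<close>
    moreover have "(norm (d (u t)))\<^sup>2 \<le> (norm (d (u 0)))\<^sup>2"
      using nonincreasing_from_0[OF Dd _ t] dissipation by simp
    moreover have "(norm (d (u 0)))\<^sup>2 \<le> e 0" by (simp add: e_def)
    ultimately show ?thesis
      unfolding e_def[symmetric] distrib_right by linarith
  qed
  moreover have "2 * L + 1 \<ge> 0" using L(1) C'(1) by simp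
  ultimately show ?thesis by (intro exI[of _ "2 * L + 1"]) auto
qed

text \<open>The form \<open>z = b u \<bullet> u\<close> decays at rate \<open>\<kappa>\<close> by
  the spectral gap, up to a source of order \<open>(norm (d u))^2\<close>, which is already known to
  decay like \<open>1 / (1 + t)\<close>. A barrier argument transfers this rate to
  \<open>z\<close>.\<close>

lemma damped_part_decay:
  "\<exists>C\<ge>0. \<forall>d u. skew_commuting d \<longrightarrow>
     (\<forall>t\<ge>0. (u has_vector_derivative flow d (u t)) (at t within {0..})) \<longrightarrow>
     (\<forall>t\<ge>0. (1 + t) * (b (u t) \<bullet> u t) \<le> C * ((norm (u 0))\<^sup>2 + (norm (d (u 0)))\<^sup>2))"
proof -
  obtain C where C: "C \<ge> 0" "\<And>d u t. skew_commuting d \<Longrightarrow>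
     (\<forall>t\<ge>0. (u has_vector_derivative flow d (u t)) (at t within {0..})) \<Longrightarrow> t \<ge> 0 \<Longrightarrow>
     (1 + t) * (norm (d (u t)))\<^sup>2 \<le> C * ((norm (u 0))\<^sup>2 + (norm (d (u 0)))\<^sup>2)"
    using derivative_decay by metis
  obtain A where A: "A \<ge> 0" "\<And>x. norm (a x) \<le> A * norm x"
    using onorm[OF bounded_linear_a] onorm_pos_le[OF bounded_linear_a] by metis
  obtain B where B: "B \<ge> 0" "\<And>x. norm (b x) \<le> B * norm x"
    using onorm[OF bounded_linear_b] onorm_pos_le[OF bounded_linear_b] by metis
  \<comment> \<open>\<open>T \<ge> 1\<close> makes \<open>t + T\<close> comparable to
    \<open>1 + t\<close>; \<open>T \<ge> 2 / \<kappa>\<close> lets half of the damping absorb the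
    derivative of the weight \<open>t + T\<close>.\<close>
  define T where "T = max 1 (2 / \<kappa>)"
  have T: "T \<ge> 1" "2 \<le> \<kappa> * T"
    using \<kappa>_pos by (auto simp: T_def max_def field_simps)
  \<comment> \<open>The first summand dominates the source term, the second the initial value
    \<open>T * z 0\<close>.\<close>
  define M where "M = 2 * A\<^sup>2 * T * C / \<kappa> + T * B"
  have M: "M \<ge> 0" "T * B \<le> M" "A\<^sup>2 * T * C \<le> \<kappa> / 2 * M"
    using T B C \<kappa>_pos by (auto simp: M_def field_simps intro!: add_nonneg_nonneg mult_nonneg_nonneg)
  have "(1 + t) * (b (u t) \<bullet> u t) \<le> M * ((norm (u 0))\<^sup>2 + (norm (d (u 0)))\<^sup>2)"
    if d: "skew_commuting d" and t: "t \<ge> 0"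
      and u: "\<forall>t\<ge>0. (u has_vector_derivative flow d (u t)) (at t within {0..})" for d u t
  proof -
    define E where "E = (norm (u 0))\<^sup>2 + (norm (d (u 0)))\<^sup>2"
    define z where "z t = b (u t) \<bullet> u t" for t
    define z' where "z' t = 2 * (b (u t) \<bullet> flow d (u t))" for t
    have z0: "z t \<ge> 0" for t
      unfolding z_def by (rule order_trans[OF _ dissipative]) (use \<kappa>_pos in simp)
    have Dz: "(z has_real_derivative z' t) (at t within {0..})" if "t \<ge> 0" for t
      using deriv_inner_flow[OF d u[rule_format, OF that] bounded_linear_b bounded_linear_ident]
      by (simp add: z_def[abs_def] z'_def b_sym inner_commute)
    \<comment> \<open>The transport term is split by Young's inequality; it uses up one of the two
      copies of \<open>(norm (b u))^2\<close>, and the other bounds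
      \<open>\<kappa> * z\<close>.\<close>
    have z': "z' t \<le> - \<kappa> * z t + A\<^sup>2 * (norm (d (u t)))\<^sup>2" for t
    proof -
      have "\<bar>b (u t) \<bullet> a (d (u t))\<bar> \<le> norm (b (u t)) * (A * norm (d (u t)))"
        using order_trans[OF Cauchy_Schwarz_ineq2 mult_left_mono[OF A(2) norm_ge_zero]] .
      moreover have "2 * norm (b (u t)) * (A * norm (d (u t)))
          \<le> (norm (b (u t)))\<^sup>2 + (A * norm (d (u t)))\<^sup>2"
        by (rule sum_squares_bound)
      moreover have "z' t = - 2 * (b (u t) \<bullet> a (d (u t))) - 2 * (norm (b (u t)))\<^sup>2"
        by (simp add: z'_def flow_def inner_diff_right dot_square_norm)
      moreover have "\<kappa> * z t \<le> (norm (b (u t)))\<^sup>2"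
        unfolding z_def by (rule spectral_gap)
      ultimately show ?thesis by (simp add: power_mult_distrib)
    qed
    \<comment> \<open>The excess over the barrier \<open>M * E\<close> times an integrating factor:
      the excess satisfies a linear differential inequality of rate \<open>\<kappa> / 2\<close> and
      is nonpositive at 0, hence remains so.\<close>
    define \<psi> where "\<psi> t = exp (\<kappa> / 2 * t) * ((t + T) * z t - M * E)" for t
    define \<psi>' where "\<psi>' t = exp (\<kappa> / 2 * t) * (\<kappa> / 2 * ((t + T) * z t - M * E) + (z t + (t + T) * z' t))" for t
    have D\<psi>: "(\<psi> has_real_derivative \<psi>' t) (at t within {0..})" if "t \<ge> 0" for t
      unfolding \<psi>_def[abs_def] \<psi>'_def
      by (rule derivative_eq_intros Dz[OF that] refl)+ (simp add: field_simps)
    have "\<psi>' t \<le> 0" if "t \<ge> 0" for t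
    proof -
      have "(t + T) * z' t \<le> (t + T) * (- \<kappa> * z t + A\<^sup>2 * (norm (d (u t)))\<^sup>2)"
        using z' that T by (intro mult_left_mono) auto
      moreover have "(t + T) * (A\<^sup>2 * (norm (d (u t)))\<^sup>2) \<le> \<kappa> / 2 * M * E"
      proof -
        have "t + T \<le> T * (1 + t)"
          using mult_right_mono[OF T(1) that] by (simp add: algebra_simps)
        then have "(t + T) * (A\<^sup>2 * (norm (d (u t)))\<^sup>2) \<le> (T * (1 + t)) * (A\<^sup>2 * (norm (d (u t)))\<^sup>2)"
          by (rule mult_right_mono) simp
        also have "\<dots> = A\<^sup>2 * T * ((1 + t) * (norm (d (u t)))\<^sup>2)" by simp
        also have "\<dots> \<le> A\<^sup>2 * T * (C * E)"
          using C(2)[OF d u that] T unfolding E_def by (intro mult_left_mono) auto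
        also have "\<dots> \<le> \<kappa> / 2 * M * E"
          using mult_right_mono[OF M(3), of E] by (simp add: E_def mult.assoc)
        finally show ?thesis .
      qed
      moreover have "z t \<le> \<kappa> / 2 * ((t + T) * z t)"
      proof -
        have "1 * z t \<le> (\<kappa> / 2 * (t + T)) * z t"
        proof (rule mult_right_mono)
          have "\<kappa> * t \<ge> 0" using that \<kappa>_pos by simp
          then show "1 \<le> \<kappa> / 2 * (t + T)" using T(2) by (simp add: distrib_left)
        qed (rule z0)
        then show ?thesis by simp
      qed
      ultimately have "\<kappa> / 2 * ((t + T) * z t - M * E) + (z t + (t + T) * z' t) \<le> 0"
        by (simp add: algebra_simps)
      then show ?thesis unfolding \<psi>'_def by (intro mult_nonneg_nonpos) auto
    qed
    then have "\<psi> t \<le> \<psi> 0"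
      using nonincreasing_from_0[OF D\<psi> _ t] by blast
    also have "\<psi> 0 \<le> 0"
    proof -
      have "z 0 \<le> B * norm (u 0) * norm (u 0)"
        unfolding z_def using order_trans[OF norm_cauchy_schwarz mult_right_mono[OF B(2) norm_ge_zero]] .
      also have "\<dots> \<le> B * E"
        using B(1) by (simp add: E_def power2_eq_square[symmetric] mult.assoc mult_left_mono)
      finally have "T * z 0 \<le> T * (B * E)"
        using T by (intro mult_left_mono) auto
      also have "\<dots> \<le> M * E"
        using mult_right_mono[OF M(2), of E] by (simp add: E_def mult.assoc)
      finally show ?thesis by (simp add: \<psi>_def)
    qed
    finally have "(t + T) * z t \<le> M * E"
      by (simp add: \<psi>_def mult_le_0_iff)
    moreover have "(1 + t) * z t \<le> (t + T) * z t"
      using T z0 by (intro mult_right_mono) auto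
    ultimately show ?thesis by (simp add: z_def E_def)
  qed
  with M(1) show ?thesis by blast
qed

end

section \<open>The Kalman condition and the discrete system\<close>

lemma sum_UNIV_Plus:
  fixes f :: "'a::finite + 'b::finite \<Rightarrow> 'c::comm_monoid_add"
  shows "(\<Sum>i\<in>UNIV. f i) = (\<Sum>i\<in>UNIV. f (Inl i)) + (\<Sum>j\<in>UNIV. f (Inr j))"
  using sum.Plus[of "UNIV :: 'a set" "UNIV :: 'b set" f] by (simp add: comp_def)

lemma lower_block_nth:
  "(lower_block M *v x) $ Inl i = 0"
  "(lower_block M *v x) $ Inr j = (M *v snd_block x) $ j"
  by (simp_all add: matrix_vector_mult_def lower_block_def snd_block_def sum_UNIV_Plus)

lemma inner_lower_block: "(lower_block M *v x) \<bullet> y = (M *v snd_block x) \<bullet> snd_block y"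
  by (simp add: inner_vec_def sum_UNIV_Plus lower_block_nth) (simp add: snd_block_def)

lemma snd_block_lower_block: "snd_block (lower_block M *v x) = M *v snd_block x"
  by (simp add: vec_eq_iff snd_block_def[of "lower_block M *v x"] lower_block_nth)

lemma norm_lower_block: "norm (lower_block M *v x) = norm (M *v snd_block x)"
  by (simp add: norm_eq_sqrt_inner inner_lower_block snd_block_lower_block)

lemma norm_snd_block_le: "norm (snd_block x) \<le> norm x"
  by (auto simp: norm_eq_sqrt_inner inner_vec_def sum_UNIV_Plus snd_block_def intro!: sum_nonneg)

text \<open>The quadratic form attains a positive minimum on the compact unit sphere; homogeneity
  extends the bound to all vectors.\<close>

lemma positive_definite_coercive:
  fixes M :: "real^'n^'n::finite"
  assumes "positive_definite M"
  obtains m where "m > 0" "\<And>x. m * (norm x)\<^sup>2 \<le> x \<bullet> (M *v x)"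
proof -
  have cont: "continuous_on (sphere 0 1) (\<lambda>x. x \<bullet> (M *v x))"
    by (intro continuous_intros linear_continuous_on matrix_vector_mul_bounded_linear)
  have "sphere (0 :: real^'n) 1 \<noteq> {}"
    using vector_choose_size[of 1, where 'a = "real^'n"] by auto
  then obtain z where z: "z \<in> sphere 0 1"
    and min: "\<And>y. y \<in> sphere 0 1 \<Longrightarrow> z \<bullet> (M *v z) \<le> y \<bullet> (M *v y)"
    using continuous_attains_inf[OF compact_sphere _ cont] by blast
  show thesis
  proof
    have "z \<noteq> 0" using z by auto
    then show "z \<bullet> (M *v z) > 0" using assms by (simp add: positive_definite_def)
    show "z \<bullet> (M *v z) * (norm x)\<^sup>2 \<le> x \<bullet> (M *v x)" for x
    proof (cases "x = 0")
      case False
      then have "z \<bullet> (M *v z) \<le> (x /\<^sub>R norm x) \<bullet> (M *v (x /\<^sub>R norm x))"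
        by (intro min) auto
      also have "\<dots> = x \<bullet> (M *v x) / (norm x)\<^sup>2"
        by (simp add: matrix_vector_mult_scaleR power2_eq_square field_simps)
      finally show ?thesis using False by (simp add: field_simps)
    qed simp
  qed
qed

lemma lower_block_spectral_bounds:
  fixes B' :: "real^'b^'b::finite"
  assumes "positive_definite B'"
  obtains \<kappa> where "\<kappa> > 0"
    and "\<And>x :: real^('a::finite + 'b). \<kappa> * (norm (lower_block B' *v x))\<^sup>2 \<le> (lower_block B' *v x) \<bullet> x"
    and "\<And>x :: real^('a + 'b). \<kappa> * ((lower_block B' *v x) \<bullet> x) \<le> (norm (lower_block B' *v x))\<^sup>2"
    and "\<And>x :: real^('a + 'b). \<kappa> * (norm (snd_block x))\<^sup>2 \<le> (lower_block B' *v x) \<bullet> x"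
proof -
  obtain m where m: "m > 0" "\<And>y. m * (norm y)\<^sup>2 \<le> y \<bullet> (B' *v y)"
    using positive_definite_coercive[OF assms] by metis
  obtain \<beta> where \<beta>: "\<beta> > 0" "\<And>y. norm (B' *v y) \<le> norm y * \<beta>"
    using bounded_linear.pos_bounded[OF matrix_vector_mul_bounded_linear[of B']] by metis
  \<comment> \<open>The three entries serve, in order, the coercivity on the second block, the
    \<open>dissipative\<close> bound and the spectral gap.\<close>
  define \<kappa> where "\<kappa> = min m (min (m / \<beta>\<^sup>2) (m\<^sup>2 / \<beta>))"
  have \<kappa>: "\<kappa> > 0" "\<kappa> \<le> m" "\<kappa> * \<beta>\<^sup>2 \<le> m" "\<kappa> * \<beta> \<le> m\<^sup>2"
  proof -
    show "\<kappa> > 0" "\<kappa> \<le> m" using m(1) \<beta>(1) by (simp_all add: \<kappa>_def)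
    have "\<kappa> \<le> m / \<beta>\<^sup>2" "\<kappa> \<le> m\<^sup>2 / \<beta>" by (simp_all add: \<kappa>_def)
    then show "\<kappa> * \<beta>\<^sup>2 \<le> m" "\<kappa> * \<beta> \<le> m\<^sup>2"
      using \<beta>(1) by (simp_all add: pos_le_divide_eq)
  qed
  have lower: "\<kappa> * (norm y)\<^sup>2 \<le> (B' *v y) \<bullet> y" for y
    using mult_right_mono[OF \<kappa>(2), of "(norm y)\<^sup>2"] m(2)[of y] by (simp add: inner_commute)
  have upper: "\<kappa> * (norm (B' *v y))\<^sup>2 \<le> (B' *v y) \<bullet> y" for y
  proof -
    have "\<kappa> * (norm (B' *v y))\<^sup>2 \<le> \<kappa> * (norm y * \<beta>)\<^sup>2"
      using \<kappa>(1) \<beta>(2) by (intro mult_left_mono power_mono) auto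
    also have "\<dots> = (\<kappa> * \<beta>\<^sup>2) * (norm y)\<^sup>2" by (simp add: power_mult_distrib)
    also have "\<dots> \<le> m * (norm y)\<^sup>2" by (intro mult_right_mono \<kappa>) auto
    finally show ?thesis using m(2)[of y] by (simp add: inner_commute)
  qed
  have gap: "\<kappa> * ((B' *v y) \<bullet> y) \<le> (norm (B' *v y))\<^sup>2" for y
  proof -
    \<comment> \<open>Coercivity and Cauchy-Schwarz, after cancelling \<open>norm y\<close>, bound
      \<open>B'\<close> itself from below.\<close>
    have "m * (norm y)\<^sup>2 \<le> norm y * norm (B' *v y)"
      using order_trans[OF m(2) norm_cauchy_schwarz] .
    then have "norm y * (m * norm y) \<le> norm y * norm (B' *v y)"
      by (simp add: power2_eq_square mult.left_commute)
    then have m_le: "m * norm y \<le> norm (B' *v y)"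
      by (cases "y = 0") (simp, metis mult_left_le_imp_le zero_less_norm_iff)
    have "(B' *v y) \<bullet> y \<le> norm (B' *v y) * norm y"
      by (rule norm_cauchy_schwarz)
    also have "\<dots> \<le> norm y * \<beta> * norm y"
      by (intro mult_right_mono \<beta>) auto
    finally have "\<kappa> * ((B' *v y) \<bullet> y) \<le> \<kappa> * (norm y * \<beta> * norm y)"
      using \<kappa>(1) by (intro mult_left_mono) auto
    also have "\<dots> = (\<kappa> * \<beta>) * (norm y)\<^sup>2" by (simp add: power2_eq_square)
    also have "\<dots> \<le> m\<^sup>2 * (norm y)\<^sup>2" by (intro mult_right_mono \<kappa>) auto
    also have "\<dots> = (m * norm y)\<^sup>2" by (simp add: power_mult_distrib)
    also have "\<dots> \<le> (norm (B' *v y))\<^sup>2" using m_le m(1) by (intro power_mono) auto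
    finally show ?thesis .
  qed
  show thesis
    by (rule that[of \<kappa>]) (simp_all add: \<kappa>(1) inner_lower_block norm_lower_block upper lower gap)
qed

section \<open>The Kalman rank condition as an observability inequality\<close>

lemma matrix_power_commute: "matrix_power A k ** A = A ** matrix_power A k"
  by (induction k) (simp_all add: matrix_mul_assoc[symmetric])

lemma transpose_matrix_power:
  "symmetric_matrix A \<Longrightarrow> transpose (matrix_power A k) = matrix_power A k"
  by (induction k) (simp_all add: transpose_mat matrix_transpose_mul symmetric_matrix_def
      matrix_power_commute)

text \<open>Full row rank means that the transposed Kalman matrix is injective, hence bounded below.
  By symmetry its blocks are \<open>B A^k\<close>, so the squared norm of its image is the sum on
  the right.\<close>

lemma kalman_observability:
  fixes A B :: "real^'n^'n::finite"
  assumes A: "symmetric_matrix A" and B: "symmetric_matrix B"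
    and rank: "rank (kalman_matrix A B) = CARD('n)"
  obtains K where "K > 0"
    "\<And>x. (norm x)\<^sup>2 \<le> K * (\<Sum>k<CARD('n). (norm (B *v (matrix_power A k *v x)))\<^sup>2)"
proof -
  let ?T = "transpose (kalman_matrix A B)"
  let ?k = "to_nat_on (UNIV :: 'n set)"
  have "inj ((*v) ?T)"
    using rank by (simp add: full_rank_injective[symmetric] rank_transpose)
  then obtain c where c: "c > 0" "\<And>x. c * norm x \<le> norm (?T *v x)"
    using linear_inj_bounded_below_pos[OF matrix_vector_mul_linear] by blast
  have T_nth: "(?T *v x) $ (i, j) = (B *v (matrix_power A (?k i) *v x)) $ j" for x i j
  proof -
    have "(?T *v x) $ (i, j) = (transpose (matrix_power A (?k i) ** B) *v x) $ j"
      by (simp add: matrix_vector_mult_def transpose_def kalman_matrix_def)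
    also have "transpose (matrix_power A (?k i) ** B) = B ** matrix_power A (?k i)"
      using A B by (simp add: matrix_transpose_mul transpose_matrix_power symmetric_matrix_def)
    finally show ?thesis by (simp add: matrix_vector_mul_assoc)
  qed
  have norm_T: "(norm (?T *v x))\<^sup>2 = (\<Sum>k<CARD('n). (norm (B *v (matrix_power A k *v x)))\<^sup>2)" for x
  proof -
    have "(norm (?T *v x))\<^sup>2 = (\<Sum>(i, j)\<in>UNIV. ((B *v (matrix_power A (?k i) *v x)) $ j)\<^sup>2)"
      unfolding dot_square_norm[symmetric] inner_vec_def
      by (intro sum.cong) (auto simp: T_nth power2_eq_square simp del: transpose_matrix_vector)
    also have "\<dots> = (\<Sum>i\<in>UNIV. \<Sum>j\<in>UNIV. ((B *v (matrix_power A (?k i) *v x)) $ j)\<^sup>2)"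
      by (simp add: sum.cartesian_product)
    also have "\<dots> = (\<Sum>i\<in>UNIV. (norm (B *v (matrix_power A (?k i) *v x)))\<^sup>2)"
      unfolding dot_square_norm[symmetric] inner_vec_def by (simp add: power2_eq_square)
    \<comment> \<open>The enumeration of the index type hits each exponent below the dimension
      exactly once.\<close>
    also have "\<dots> = (\<Sum>k<CARD('n). (norm (B *v (matrix_power A k *v x)))\<^sup>2)"
      by (rule sum.reindex_bij_betw) (rule to_nat_on_finite, simp)
    finally show ?thesis .
  qed
  show thesis
  proof (rule that[of "1 / c\<^sup>2"])
    show "1 / c\<^sup>2 > 0" using c(1) by simp
    fix x
    have "(c * norm x)\<^sup>2 \<le> (norm (?T *v x))\<^sup>2"
      using c by (intro power_mono) auto
    then show "(norm x)\<^sup>2 \<le> 1 / c\<^sup>2 * (\<Sum>k<CARD('n). (norm (B *v (matrix_power A k *v x)))\<^sup>2)"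
      using c(1) unfolding norm_T[symmetric] by (simp add: power_mult_distrib field_simps)
  qed
qed

section \<open>Transfer to square-summable sequences\<close>

lemma norm_sq_ell2: "(norm u)\<^sup>2 = (\<Sum>\<^sub>\<infinity>n. (norm (seq_of u n))\<^sup>2)"
  by (simp add: dot_square_norm[symmetric] inner_ell2.rep_eq)

text \<open>The inequality holds at each grid point; it is summed over the grid, exchanging the
  finite and the infinite sum.\<close>

lemma ell2_observability:
  fixes A B :: "real^'n^'n::finite"
  assumes "\<And>x. (norm x)\<^sup>2 \<le> K * (\<Sum>k<N. (norm (B *v (matrix_power A k *v x)))\<^sup>2)"
  shows "(norm u)\<^sup>2 \<le> K * (\<Sum>k<N. (norm (map_matrix B ((map_matrix A ^^ k) u)))\<^sup>2)"
proof -
  let ?v = "\<lambda>k. map_matrix B ((map_matrix A ^^ k) u)"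
  have summable: "(\<lambda>n. (norm (seq_of v n))\<^sup>2) summable_on UNIV" for v :: "(real^'n) ell2"
    using seq_of[of v] by (simp add: l2h_def)
  have sums: "((\<lambda>n. \<Sum>k<N. (norm (seq_of (?v k) n))\<^sup>2) has_sum (\<Sum>k<N. (norm (?v k))\<^sup>2)) UNIV"
    unfolding norm_sq_ell2 by (induction N) (auto intro!: has_sum_add has_sum_infsum summable)
  have "(norm u)\<^sup>2 \<le> (\<Sum>\<^sub>\<infinity>n. K * (\<Sum>k<N. (norm (seq_of (?v k) n))\<^sup>2))"
    unfolding norm_sq_ell2
    using sums
    by (intro infsum_mono summable summable_on_cmult_right)
      (auto simp: has_sum_iff map_matrix_power map_matrix.rep_eq assms)
  also have "\<dots> = K * (\<Sum>k<N. (norm (?v k))\<^sup>2)"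
    using infsumI[OF sums] by (simp add: infsum_cmult_right')
  finally show ?thesis .
qed

lemma ell2_has_vector_derivative:
  assumes h: "h > 0" and C1: "C1_l2h h U V" and t: "t \<ge> 0"
  shows "((\<lambda>s. Abs_ell2 (U s)) has_vector_derivative Abs_ell2 (V t)) (at t within {0..})"
proof -
  define u v where "u s = Abs_ell2 (U s)" and "v = Abs_ell2 (V t)" for s
  have U: "seq_of (u s) = U s" if "s \<ge> 0" for s
    using C1 that by (simp add: u_def C1_l2h_def Abs_ell2_inverse)
  have V: "seq_of v = V t"
    using C1 t by (simp add: v_def C1_l2h_def Abs_ell2_inverse)
  \<comment> \<open>For negative \<open>s\<close> the value \<open>U s\<close> need not lie in
    \<open>l2h\<close> and \<open>Abs_ell2\<close> is uninformative; the filter only sees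
    \<open>s \<ge> 0\<close> with \<open>s \<noteq> t\<close>.\<close>
  have quotient: "l2h_norm h (\<lambda>n. (U s n - U t n) /\<^sub>R (s - t) - V t n)
      = sqrt h * (norm (u s - u t - (s - t) *\<^sub>R v) / norm (s - t))" if "s \<ge> 0" "s \<noteq> t" for s
  proof -
    have "l2h_norm h (\<lambda>n. (U s n - U t n) /\<^sub>R (s - t) - V t n)
        = l2h_norm h (seq_of ((u s - u t) /\<^sub>R (s - t) - v))"
      using U[OF that(1)] U[OF t] V by (simp add: minus_ell2.rep_eq scaleR_ell2.rep_eq)
    also have "\<dots> = sqrt h * norm ((u s - u t) /\<^sub>R (s - t) - v)"
      by (rule l2h_norm_seq_of[OF h])
    also have "(u s - u t) /\<^sub>R (s - t) - v = (u s - u t - (s - t) *\<^sub>R v) /\<^sub>R (s - t)"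
      using that(2) by (simp add: scaleR_diff_right)
    finally show ?thesis by (simp add: divide_inverse mult.commute)
  qed
  have "((\<lambda>s. l2h_norm h (\<lambda>n. (U s n - U t n) /\<^sub>R (s - t) - V t n)) \<longlongrightarrow> 0) (at t within {0..})"
    using C1 t by (simp add: C1_l2h_def)
  then have "((\<lambda>s. 1 / sqrt h * l2h_norm h (\<lambda>n. (U s n - U t n) /\<^sub>R (s - t) - V t n)) \<longlongrightarrow> 0) (at t within {0..})"
    by (rule tendsto_mult_right_zero)
  moreover have "\<forall>\<^sub>F s in at t within {0..}. 1 / sqrt h * l2h_norm h (\<lambda>n. (U s n - U t n) /\<^sub>R (s - t) - V t n)
      = norm (u s - u t - (s - t) *\<^sub>R v) / norm (s - t)"
    unfolding eventually_at_filter by (rule always_eventually) (use h quotient in simp)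
  ultimately have "((\<lambda>s. norm (u s - u t - (s - t) *\<^sub>R v) / norm (s - t)) \<longlongrightarrow> 0) (at t within {0..})"
    by (simp add: tendsto_cong)
  then have "(u has_vector_derivative v) (at t within {0..})"
    unfolding has_vector_derivative_def has_derivative_iff_norm
    by (simp add: bounded_linear_scaleR_left)
  then show ?thesis by (simp add: u_def[abs_def] v_def)
qed

lemma ell2_snd_block:
  fixes u :: "(real^('a::finite + 'b::finite)) ell2"
  obtains w where "seq_of w = (\<lambda>n. snd_block (seq_of u n))"
proof
  have "(\<lambda>n. snd_block (seq_of u n)) \<in> l2h"
    by (rule l2h_bounded_image[where K = 1, OF seq_of[of u]]) (simp add: norm_snd_block_le)
  then show "seq_of (Abs_ell2 (\<lambda>n. snd_block (seq_of u n))) = (\<lambda>n. snd_block (seq_of u n))"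
    by (rule Abs_ell2_inverse)
qed

lemma le_of_weighted_square_le:
  fixes x t C E :: real
  assumes "(1 + t) * x\<^sup>2 \<le> C * E" "t \<ge> 0"
  shows "x \<le> sqrt C * (1 + t) powr (- 1 / 2) * sqrt E"
proof -
  have "x \<le> sqrt (x\<^sup>2)" by simp
  also have "\<dots> \<le> sqrt (C * E / (1 + t))"
    using assms by (intro real_sqrt_le_mono) (simp add: pos_le_divide_eq mult.commute)
  also have "\<dots> = sqrt C * (1 + t) powr (- 1 / 2) * sqrt E"
    using assms(2) by (simp add: powr_minus powr_half_sqrt real_sqrt_mult real_sqrt_divide field_simps)
  finally show ?thesis .
qed

section \<open>Decay of the semi-discrete system, uniformly in the mesh size\<close>

theorem theorem2p1:
  fixes A B :: "real ^ ('a::finite + 'b::finite) ^ ('a + 'b)"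
    and B' :: "real ^ 'b ^ 'b"
  assumes "symmetric_matrix A"
    and "symmetric_matrix B"
    and "B = lower_block B'"
    and "symmetric_matrix B'"
    and "positive_definite B'"
    and "rank (kalman_matrix A B) = CARD('a + 'b)"
  shows "\<exists>C>0. \<forall>h>0. \<forall>U0\<in>h1h h. \<forall>U. is_solution A B h U0 U \<longrightarrow>
           (\<forall>t>0. l2h_norm h (\<lambda>n. snd_block (U t n)) + l2h_norm h (Dh h (U t))
                    \<le> C * (1 + t) powr (- 1 / 2) * h1h_norm h U0)"
proof -
  obtain \<kappa> where \<kappa>: "\<kappa> > 0"
    "\<And>x. \<kappa> * (norm (B *v x))\<^sup>2 \<le> (B *v x) \<bullet> x"
    "\<And>x. \<kappa> * ((B *v x) \<bullet> x) \<le> (norm (B *v x))\<^sup>2"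
    "\<And>x. \<kappa> * (norm (snd_block x))\<^sup>2 \<le> (B *v x) \<bullet> x"
    using lower_block_spectral_bounds[OF assms(5), where 'a = 'a] unfolding assms(3) by metis
  obtain K where K: "K > 0"
    "\<And>x. (norm x)\<^sup>2 \<le> K * (\<Sum>k<CARD('a + 'b). (norm (B *v (matrix_power A k *v x)))\<^sup>2)"
    using kalman_observability[OF assms(1,2,6)] by metis
  \<comment> \<open>No \<open>h\<close> is fixed yet, so the decay constants obtained from this
    interpretation depend only on the matrices.\<close>
  interpret kalman_dissipative "map_matrix A" "map_matrix B" "CARD('a + 'b)" \<kappa> K
  proof (rule kalman_dissipative.intro)
    fix u v :: "(real ^ ('a + 'b)) ell2"
    show "map_matrix A u \<bullet> v = u \<bullet> map_matrix A v" "map_matrix B u \<bullet> v = u \<bullet> map_matrix B v"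
      using assms(1,2) by (simp_all add: inner_map_matrix_left symmetric_matrix_def)
    have "(\<kappa> *\<^sub>R map_matrix B u) \<bullet> map_matrix B u \<le> map_matrix B u \<bullet> u"
      by (rule inner_ell2_mono) (simp add: map_matrix.rep_eq scaleR_ell2.rep_eq dot_square_norm \<kappa>)
    then show "\<kappa> * (norm (map_matrix B u))\<^sup>2 \<le> map_matrix B u \<bullet> u"
      by (simp add: dot_square_norm)
    have "(\<kappa> *\<^sub>R map_matrix B u) \<bullet> u \<le> map_matrix B u \<bullet> map_matrix B u"
      by (rule inner_ell2_mono) (simp add: map_matrix.rep_eq scaleR_ell2.rep_eq dot_square_norm \<kappa>)
    then show "\<kappa> * (map_matrix B u \<bullet> u) \<le> (norm (map_matrix B u))\<^sup>2"
      by (simp add: dot_square_norm)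
    show "(norm u)\<^sup>2 \<le> K * (\<Sum>k<CARD('a + 'b). (norm (map_matrix B ((map_matrix A ^^ k) u)))\<^sup>2)"
      by (rule ell2_observability[OF K(2)])
  qed (rule bounded_linear_map_matrix \<kappa>(1) K(1))+
  obtain C1 where C1: "C1 \<ge> 0" "\<And>d u t. skew_commuting d \<Longrightarrow>
     (\<forall>t\<ge>0. (u has_vector_derivative flow d (u t)) (at t within {0..})) \<Longrightarrow> t \<ge> 0 \<Longrightarrow>
     (1 + t) * (norm (d (u t)))\<^sup>2 \<le> C1 * ((norm (u 0))\<^sup>2 + (norm (d (u 0)))\<^sup>2)"
    using derivative_decay by metis
  obtain C2 where C2: "C2 \<ge> 0" "\<And>d u t. skew_commuting d \<Longrightarrow>
     (\<forall>t\<ge>0. (u has_vector_derivative flow d (u t)) (at t within {0..})) \<Longrightarrow> t \<ge> 0 \<Longrightarrow>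
     (1 + t) * (map_matrix B (u t) \<bullet> u t) \<le> C2 * ((norm (u 0))\<^sup>2 + (norm (d (u 0)))\<^sup>2)"
    using damped_part_decay by metis
  \<comment> \<open>The \<open>+ 1\<close> ensures positivity, as \<open>C1\<close> and
    \<open>C2\<close> are only known to be nonnegative.\<close>
  define C where "C = sqrt (C2 / \<kappa>) + sqrt C1 + 1"
  have "l2h_norm h (\<lambda>n. snd_block (U t n)) + l2h_norm h (Dh h (U t))
      \<le> C * (1 + t) powr (- 1 / 2) * h1h_norm h U0"
    if h: "h > 0" and sol: "is_solution A B h U0 U" and t: "t > 0" for h U0 U t
  proof -
    obtain V where V: "C1_l2h h U V" "\<And>t n. t \<ge> 0 \<Longrightarrow> V t n + A *v Dh h (U t) n = - (B *v U t n)"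
      and U0: "U 0 = U0"
      using sol unfolding is_solution_def by blast
    let ?d = "central_diff h :: (real ^ ('a + 'b)) ell2 \<Rightarrow> _"
    define u where "u t = Abs_ell2 (U t)" for t
    have U: "seq_of (u t) = U t" if "t \<ge> 0" for t
      using V(1) that by (simp add: u_def C1_l2h_def Abs_ell2_inverse)
    have d: "skew_commuting ?d"
      unfolding skew_commuting_def
      using bounded_linear_central_diff central_diff_skew map_matrix_central_diff by metis
    have u: "\<forall>t\<ge>0. (u has_vector_derivative flow ?d (u t)) (at t within {0..})"
    proof (intro allI impI)
      fix t :: real assume t: "t \<ge> 0"
      have "V t n = seq_of (flow ?d (u t)) n" for n
      proof -
        have "V t n = (V t n + A *v Dh h (U t) n) - A *v Dh h (U t) n" by simp
        also have "\<dots> = - (A *v Dh h (U t) n) - B *v U t n"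
          unfolding V(2)[OF t] by simp
        also have "\<dots> = seq_of (flow ?d (u t)) n"
          by (simp add: flow_def minus_ell2.rep_eq uminus_ell2.rep_eq map_matrix.rep_eq
              seq_of_central_diff U[OF t])
        finally show ?thesis .
      qed
      then have "Abs_ell2 (V t) = flow ?d (u t)"
        by (metis ext seq_of_inverse)
      then show "(u has_vector_derivative flow ?d (u t)) (at t within {0..})"
        using ell2_has_vector_derivative[OF h V(1) t] by (simp add: u_def[abs_def])
    qed
    define E where "E = (norm (u 0))\<^sup>2 + (norm (?d (u 0)))\<^sup>2"
    obtain w where w: "seq_of w = (\<lambda>n. snd_block (seq_of (u t) n))"
      by (rule ell2_snd_block)
    \<comment> \<open>Coercivity of the damping on the second block turns decay of the damped form
      into decay of \<open>w\<close>, which represents the second component.\<close>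
    have "(\<kappa> *\<^sub>R w) \<bullet> w \<le> map_matrix B (u t) \<bullet> u t"
      by (rule inner_ell2_mono) (simp add: map_matrix.rep_eq scaleR_ell2.rep_eq w dot_square_norm \<kappa>)
    then have "(1 + t) * (\<kappa> * (norm w)\<^sup>2) \<le> (1 + t) * (map_matrix B (u t) \<bullet> u t)"
      using t by (intro mult_left_mono) (auto simp: dot_square_norm)
    also have "\<dots> \<le> C2 * E"
      unfolding E_def using C2(2)[OF d u] t by simp
    finally have "(1 + t) * (norm w)\<^sup>2 \<le> C2 / \<kappa> * E"
      using \<kappa>(1) by (simp add: field_simps)
    then have 1: "norm w \<le> sqrt (C2 / \<kappa>) * (1 + t) powr (- 1 / 2) * sqrt E"
      using le_of_weighted_square_le t by simp
    have "(1 + t) * (norm (?d (u t)))\<^sup>2 \<le> C1 * E"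
      unfolding E_def using C1(2)[OF d u] t by simp
    then have 2: "norm (?d (u t)) \<le> sqrt C1 * (1 + t) powr (- 1 / 2) * sqrt E"
      using le_of_weighted_square_le t by simp
    have "norm w + norm (?d (u t)) \<le> (C - 1) * (1 + t) powr (- 1 / 2) * sqrt E"
      using add_mono[OF 1 2] by (simp add: C_def algebra_simps)
    also have "\<dots> \<le> C * (1 + t) powr (- 1 / 2) * sqrt E"
      by (intro mult_right_mono) (auto simp: E_def)
    \<comment> \<open>Both sides of the claim carry the same factor \<open>sqrt h\<close>, so
      restoring the mesh weight leaves the constant unchanged.\<close>
    finally have "sqrt h * (norm w + norm (?d (u t))) \<le> sqrt h * (C * (1 + t) powr (- 1 / 2) * sqrt E)"
      using h by (intro mult_left_mono) auto
    moreover have "l2h_norm h (\<lambda>n. snd_block (U t n)) = sqrt h * norm w"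
      using l2h_norm_seq_of[OF h, of w] U[of t] t by (simp add: w)
    moreover have "l2h_norm h (Dh h (U t)) = sqrt h * norm (?d (u t))"
      using l2h_norm_seq_of[OF h, of "?d (u t)"] U[of t] t by (simp add: seq_of_central_diff)
    moreover have "h1h_norm h U0 = sqrt h * sqrt E"
      using l2h_norm_seq_of[OF h, of "?d (u 0)"] l2h_norm_seq_of[OF h, of "u 0"] U[of 0] U0 h
      by (simp add: h1h_norm_def E_def seq_of_central_diff power_mult_distrib distrib_left[symmetric]
          real_sqrt_mult)
    ultimately show ?thesis by (simp add: distrib_left mult.left_commute)
  qed
  moreover have "C > 0"
    using C1(1) C2(1) \<kappa>(1) by (simp add: C_def add_nonneg_pos)
  ultimately show ?thesis by blast
qed

end
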